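(* Let $X$ and $Y$ be Banach spaces. If $X,Y\in\mathrm{ACK}$, then the injective tensor product $X\hat{\otimes}_\varepsilon Y\in\mathrm{ACK}$. If $\rho\in[0,1)$ and $X,Y\in\mathrm{ACK}_\rho$, then $X\hat{\otimes}_\varepsilon Y\in\mathrm{ACK}_\rho$.
   Context: Banach spaces are over $\mathbb{K}\in\{\mathbb{R},\mathbb{C}\}$. The injective tensor product $X\hat{\otimes}_\varepsilon Y$ is the completion of $X\otimes Y$ under $\|z\|_\varepsilon=\sup\{|\langle x^*\otimes y^*,z\rangle|: x^*\in B_{X^*}, y^*\in B_{Y^*}\}$, where $\langle x^*\otimes y^*,x\otimes y\rangle=x^*(x)y^*(y)$. $B_X$, $S_X$ are the closed unit ball and unit sphere; $L(X)$ is the space of bounded linear operators on $X$; $w^*$ is the weak-star topology; $\mathrm{aco}\{0,V\}$ is the absolutely convex hull of $V\cup\{0\}$. A set $\Gamma\subset B_{X^*}$ is $1$-norming if $\|x\|=\sup_{x^*\in\Gamma}|x^*(x)|$ for all $x\in X$. ACK structure. For $\rho\in[0,1)$, $X\in\mathrm{ACK}_\rho$ if there is a $1$-norming set $\Gamma\subset B_{X^*}$ such that for every $\varepsilon>0$ and every non-empty relatively $w^*$-open $U\subset\Gamma$ there exist a non-empty $V\subset U$, vectors $x_1^*\in V$, $e\in S_X$ and an operator $F\in L(X)$ with: (I) $\|Fe\|=\|F\|=1$; (II) $x_1^*(Fe)=1$; (III) $F^*x_1^*=x_1^*$; (IV) denoting $V_1=\{x^*\in\Gamma:\|F^*x^*\|+(1-\varepsilon)\|(I_{X^*}-F^*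 )(x^* )\|\le 1\}$, one has $|v^*(Fe)|\le\rho$ for every $v^*\in\Gamma\setminus V_1$; (V) $\mathrm{dist}(F^*x^*,\mathrm{aco}\{0,V\})<\varepsilon$ for every $x^*\in\Gamma$; (VI) $|v^*(e)-1|\le\varepsilon$ for every $v^*\in V$. $X\in\mathrm{ACK}$ (simple ACK structure) if the same holds with (IV) replaced by $V_1=\Gamma$. *)

theory Defs
  imports "HOL-Analysis.Analysis"
begin

text \<open>
  Banach spaces over \<open>K\<close>.  The norm, the addition and the completeness come from the class
  \<^class>\<open>banach\<close>; the multiplication by scalars is an explicit map extending the real one.
  By the Gelfand--Mazur theorem a \<^class>\<open>real_normed_field\<close> is isometrically isomorphic
  to \<open>\<real>\<close> or to the complex numbers, so this class expresses exactly that the scalars are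
  real or complex.
\<close>

locale banach_over = vector_space scale
  for scale :: "'k::real_normed_field \<Rightarrow> 'a::banach \<Rightarrow> 'a" +
  assumes scale_of_real: "scale (of_real r) x = r *\<^sub>R x"
    and norm_scale: "norm (scale c x) = norm c * norm x"

text \<open>
  Bounded \<open>K\<close>-linear maps.  Their operator norm is \<^const>\<open>onorm\<close>, and the adjoint of \<open>F\<close>
  is \<open>\<lambda>f. f \<circ> F\<close>.
\<close>

definition bounded_ops ::
  "('k::field \<Rightarrow> 'a::real_normed_vector \<Rightarrow> 'a) \<Rightarrow> ('k \<Rightarrow> 'b::real_normed_vector \<Rightarrow> 'b) \<Rightarrow> ('a \<Rightarrow> 'b) set"
  where "bounded_ops sX sY = {F. Vector_Spaces.linear sX sY F \<and> bounded_linear F}"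

definition dual_space ::
  "('k::real_normed_field \<Rightarrow> 'a::real_normed_vector \<Rightarrow> 'a) \<Rightarrow> ('a \<Rightarrow> 'k) set"
  where "dual_space sX = bounded_ops sX (*)"

definition dual_ball ::
  "('k::real_normed_field \<Rightarrow> 'a::real_normed_vector \<Rightarrow> 'a) \<Rightarrow> ('a \<Rightarrow> 'k) set"
  where "dual_ball sX = {f \<in> dual_space sX. onorm f \<le> 1}"

text \<open>
  The topology of the function type is the product topology, i.e. pointwise convergence, so its
  restriction to the dual space is the weak-star topology.
\<close>

definition weak_star ::
  "('k::real_normed_field \<Rightarrow> 'a::real_normed_vector \<Rightarrow> 'a) \<Rightarrow> ('a \<Rightarrow> 'k) topology"
  where "weak_star sX = top_of_set (dual_space sX)"

text \<open>
  Nonemptiness is implied by the norming condition on a nonzero space; it is stated because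
  the supremum of an empty set of reals is an unspecified real number.
\<close>

definition one_norming ::
  "('k::real_normed_field \<Rightarrow> 'a::real_normed_vector \<Rightarrow> 'a) \<Rightarrow> ('a \<Rightarrow> 'k) set \<Rightarrow> bool"
  where "one_norming sX \<Gamma> \<longleftrightarrow>
    \<Gamma> \<noteq> {} \<and> \<Gamma> \<subseteq> dual_ball sX \<and> (\<forall>x. norm x = (SUP f\<in>\<Gamma>. norm (f x)))"

definition abs_convex :: "('a \<Rightarrow> 'k::real_normed_field) set \<Rightarrow> bool"
  where "abs_convex S \<longleftrightarrow>
    (\<forall>f\<in>S. \<forall>g\<in>S. \<forall>a b. norm a + norm b \<le> 1 \<longrightarrow> (\<lambda>x. a * f x + b * g x) \<in> S)"

definition aco0 :: "('a \<Rightarrow> 'k::real_normed_field) set \<Rightarrow> ('a \<Rightarrow> 'k) set"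
  where "aco0 V = abs_convex hull (insert (\<lambda>_. 0) V)"

text \<open>Distance from a functional to a set of functionals in the dual norm.\<close>

definition dual_dist ::
  "('a::real_normed_vector \<Rightarrow> 'k::real_normed_field) \<Rightarrow> ('a \<Rightarrow> 'k) set \<Rightarrow> real"
  where "dual_dist f A = (INF g\<in>A. onorm (\<lambda>x. f x - g x))"

definition ACK_V1 ::
  "('a::real_normed_vector \<Rightarrow> 'k::real_normed_field) set \<Rightarrow> real \<Rightarrow> ('a \<Rightarrow> 'a) \<Rightarrow> ('a \<Rightarrow> 'k) set"
  where "ACK_V1 \<Gamma> \<epsilon> F =
    {f \<in> \<Gamma>. onorm (f \<circ> F) + (1 - \<epsilon>) * onorm (\<lambda>x. f x - (f \<circ> F) x) \<le> 1}"

text \<open>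
  The common part of the two ACK structures.  The parameter \<open>P\<close> is condition (IV), as a
  property of \<open>\<Gamma>\<close>, \<open>V\<^sub>1\<close> and the vector \<open>F e\<close>.
\<close>

definition ACK_structure ::
  "(('a \<Rightarrow> 'k) set \<Rightarrow> ('a \<Rightarrow> 'k) set \<Rightarrow> 'a \<Rightarrow> bool) \<Rightarrow>
    ('k::real_normed_field \<Rightarrow> 'a::real_normed_vector \<Rightarrow> 'a) \<Rightarrow> bool"
  where "ACK_structure P sX \<longleftrightarrow>
    (\<exists>\<Gamma>. one_norming sX \<Gamma> \<and>
      (\<forall>\<epsilon>>0. \<forall>U. openin (subtopology (weak_star sX) \<Gamma>) U \<and> U \<noteq> {} \<longrightarrow>
        (\<exists>V x1 e F. V \<noteq> {} \<and> V \<subseteq> U \<and> x1 \<in> V \<and> norm e = 1 \<and> F \<in> bounded_ops sX sX \<and>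
          norm (F e) = 1 \<and> onorm F = 1 \<and>
          x1 (F e) = 1 \<and>
          x1 \<circ> F = x1 \<and>
          P \<Gamma> (ACK_V1 \<Gamma> \<epsilon> F) (F e) \<and>
          (\<forall>f\<in>\<Gamma>. dual_dist (f \<circ> F) (aco0 V) < \<epsilon>) \<and>
          (\<forall>v\<in>V. norm (v e - 1) \<le> \<epsilon>))))"

definition ACK_rho ::
  "real \<Rightarrow> ('k::real_normed_field \<Rightarrow> 'a::real_normed_vector \<Rightarrow> 'a) \<Rightarrow> bool"
  where "ACK_rho \<rho> = ACK_structure (\<lambda>\<Gamma> V1 u. \<forall>v\<in>\<Gamma> - V1. norm (v u) \<le> \<rho>)"

definition ACK :: "('k::real_normed_field \<Rightarrow> 'a::real_normed_vector \<Rightarrow> 'a) \<Rightarrow> bool"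
  where "ACK = ACK_structure (\<lambda>\<Gamma> V1 u. V1 = \<Gamma>)"

text \<open>
  An element of the algebraic tensor product \<open>X \<otimes> Y\<close> is given by a list of pairs \<open>(x, y)\<close>
  representing it as a sum of elementary tensors.  The pairing with \<open>f \<otimes> g\<close>, hence the
  injective norm, depends only on the element represented.
\<close>

definition injective_norm ::
  "('k::real_normed_field \<Rightarrow> 'a::real_normed_vector \<Rightarrow> 'a) \<Rightarrow>
    ('k \<Rightarrow> 'b::real_normed_vector \<Rightarrow> 'b) \<Rightarrow> ('a \<times> 'b) list \<Rightarrow> real"
  where "injective_norm sX sY zs =
    (SUP (f, g) \<in> dual_ball sX \<times> dual_ball sY. norm (\<Sum>(x, y)\<leftarrow>zs. f x * g y))"

text \<open>
  The space \<open>Z\<close> together with the map \<open>t\<close> is a completion of \<open>X \<otimes> Y\<close> under the injective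
  norm.  By the universal property, a linear map from \<open>X \<otimes> Y\<close> to \<open>Z\<close> is a bilinear map
  \<open>t\<close>, sending the sum of the \<open>x \<otimes> y\<close> to the sum of the \<open>t x y\<close>; it has to be isometric and
  to have dense range, and \<open>Z\<close> has to be complete.  This determines \<open>(Z, t)\<close> up to a unique
  isometric isomorphism.
\<close>

definition injective_tensor_product ::
  "('k::real_normed_field \<Rightarrow> 'a::banach \<Rightarrow> 'a) \<Rightarrow> ('k \<Rightarrow> 'b::banach \<Rightarrow> 'b) \<Rightarrow>
    ('k \<Rightarrow> 'c::banach \<Rightarrow> 'c) \<Rightarrow> ('a \<Rightarrow> 'b \<Rightarrow> 'c) \<Rightarrow> bool"
  where "injective_tensor_product sX sY sZ t \<longleftrightarrow>
    banach_over sZ \<and>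
    (\<forall>x. Vector_Spaces.linear sY sZ (\<lambda>y. t x y)) \<and>
    (\<forall>y. Vector_Spaces.linear sX sZ (\<lambda>x. t x y)) \<and>
    (\<forall>zs. norm (\<Sum>(x, y)\<leftarrow>zs. t x y) = injective_norm sX sY zs) \<and>
    closure (range (\<lambda>zs. \<Sum>(x, y)\<leftarrow>zs. t x y)) = UNIV"

end

theory Submission imports Defs begin

text \<open>
  Both assertions have one proof.  The sets \<open>V\<^sub>1\<close> are always contained in \<open>\<Gamma>\<close>, so the simple
  ACK structure is the structure with parameter \<open>\<rho> = -1\<close>: no functional satisfies
  \<open>\<bar>v (F e)\<bar> \<le> -1\<close>, hence \<open>\<Gamma> - V\<^sub>1\<close> has to be empty (\<open>ACK_eq_ACK_rho\<close>).

  Everything on the tensor product is the tensor product of the data on the factors: the norming set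
  consists of the functionals \<open>f \<otimes> g\<close> with \<open>f \<in> \<Gamma>\<^sub>X\<close> and \<open>g \<in> \<Gamma>\<^sub>Y\<close>, and
  \<open>V = V\<^sub>X \<otimes> V\<^sub>Y\<close>, \<open>e = e\<^sub>X \<otimes> e\<^sub>Y\<close>, \<open>T = F \<otimes> G\<close>.

  The functionals \<open>f \<otimes> g\<close> are norming, since the supremum over two dual balls defining the
  injective norm may be computed one variable at a time, and in each variable a norming set replaces the
  ball (\<open>norm_tensor_le\<close>, \<open>one_norming_dual_tensor\<close>).  On bounded sets the map
  \<open>(f, g) \<mapsto> f \<otimes> g\<close> is weak-star continuous, because evaluation at a point of the completion is
  a uniform limit of evaluations at finite sums of elementary tensors
  (\<open>continuous_on_dual_tensor\<close>).  Hence a nonempty relatively open set of functionals contains a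
  product of nonempty relatively open sets, to which the structures of the factors apply.

  The two quantitative conditions come from the splitting
  \<open>f \<otimes> g - f' \<otimes> g' = (f - f') \<otimes> g + f' \<otimes> (g - g')\<close> (\<open>onorm_dual_tensor_diff\<close>).  For the distance to the absolutely
  convex hull it adds the two errors, so the factors are used with at most half the tolerance.  For the
  membership in \<open>V\<^sub>1\<close>, with \<open>a = \<parallel>f \<circ> F\<parallel>\<close> and \<open>b = \<parallel>g \<circ> G\<parallel>\<close>, it bounds \<open>(1 - \<delta>)\<close> times
  the norm of the difference by \<open>(1 - a) + a (1 - b) = 1 - a b\<close>, while the adjoint of \<open>T\<close> sends
  \<open>f \<otimes> g\<close> to a functional of norm at most \<open>a b\<close> (\<open>ACK_V1_dual_tensor\<close>).  Consequently, if \<open>f \<otimes> g\<close>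
  lies outside \<open>V\<^sub>1\<close>, then so does \<open>f\<close> or \<open>g\<close>, and \<open>\<bar>f (F e\<^sub>X)\<bar> \<bar>g (G e\<^sub>Y)\<bar> \<le> \<rho>\<close> because both
  factors are at most 1.
\<close>

section \<open>Bounded operators, dual balls and norming sets\<close>

lemma bounded_ops_linear:
  assumes "F \<in> bounded_ops sX sY"
  shows "bounded_linear F" "F (x + y) = F x + F y" "F (sX c x) = sY c (F x)"
  using assms by (auto simp: bounded_ops_def Vector_Spaces.linear_iff)

lemma bounded_ops_norm_le:
  assumes "F \<in> bounded_ops sX sY"
  shows "norm (F x) \<le> onorm F * norm x"
  using onorm[OF bounded_ops_linear(1)[OF assms]] .

lemma bounded_ops_compose:
  assumes "F \<in> bounded_ops sX sY" "G \<in> bounded_ops sY sZ"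
  shows "G \<circ> F \<in> bounded_ops sX sZ"
  using assms
  by (auto simp: bounded_ops_def Vector_Spaces.linear_iff o_def intro: bounded_linear_compose)

lemma (in banach_over) bounded_opsI:
  assumes W: "banach_over sW"
    and add: "\<And>x y. T (x + y) = T x + T y"
    and scl: "\<And>c x. T (scale c x) = sW c (T x)"
    and bound: "\<And>x. norm (T x) \<le> C * norm x"
  shows "T \<in> bounded_ops scale sW"
proof -
  interpret W: banach_over sW by fact
  have "T (r *\<^sub>R x) = r *\<^sub>R T x" for r x
    using scl[of "of_real r" x] by (simp add: scale_of_real W.scale_of_real)
  then have "bounded_linear T"
    using add bound by (intro bounded_linear_intro[where K = C]) (auto simp: mult.commute)
  then show ?thesis
    using add scl vector_space_axioms W.vector_space_axioms
    by (auto simp: bounded_ops_def Vector_Spaces.linear_iff)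
qed

lemma (in banach_over) continuous_on_scale: "continuous_on S (scale c)"
proof -
  have "bounded_linear (scale c)"
    by (rule bounded_linear_intro[where K = "norm c"])
      (auto simp: scale_right_distrib norm_scale mult.commute simp flip: scale_of_real)
  then show ?thesis by (rule linear_continuous_on)
qed

lemma dual_space_linear:
  assumes "f \<in> dual_space sX"
  shows "bounded_linear f" "f (x + y) = f x + f y" "f (sX c x) = c * f x"
  using bounded_ops_linear[OF assms[unfolded dual_space_def]] by auto

lemma onorm_dual_space_nonneg: "f \<in> dual_space sX \<Longrightarrow> 0 \<le> onorm f"
  by (intro onorm_pos_le dual_space_linear(1))

lemma dual_ball_dual_space: "f \<in> dual_ball sX \<Longrightarrow> f \<in> dual_space sX"
  by (simp add: dual_ball_def)

lemma dual_space_combination: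
  assumes "f \<in> dual_space sX" "g \<in> dual_space sX"
  shows "(\<lambda>x. a * f x + b * g x) \<in> dual_space sX"
  using assms
  by (auto simp: dual_space_def bounded_ops_def Vector_Spaces.linear_iff algebra_simps
      intro!: bounded_linear_add bounded_linear_compose[OF bounded_linear_mult_right])

lemma dual_space_diff:
  assumes "f \<in> dual_space sX" "g \<in> dual_space sX"
  shows "(\<lambda>x. f x - g x) \<in> dual_space sX"
  using dual_space_combination[OF assms, of 1 "-1"] by simp

lemma dual_ball_norm_le:
  assumes "f \<in> dual_ball sX"
  shows "norm (f x) \<le> norm x"
proof -
  have f: "f \<in> bounded_ops sX (*)" "onorm f \<le> 1"
    using assms by (auto simp: dual_ball_def dual_space_def)
  have "norm (f x) \<le> onorm f * norm x" by (rule bounded_ops_norm_le[OF f(1)])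
  also have "\<dots> \<le> 1 * norm x" by (intro mult_right_mono f(2)) simp
  finally show ?thesis by simp
qed

lemma dual_ballI:
  assumes "f \<in> dual_space sX" "\<And>x. norm (f x) \<le> norm x"
  shows "f \<in> dual_ball sX"
  using assms by (auto simp: dual_ball_def intro: onorm_bound)

lemma dual_ball_compose:
  assumes "f \<in> dual_ball sX" "F \<in> bounded_ops sX sX" "onorm F \<le> 1"
  shows "f \<circ> F \<in> dual_ball sX"
proof (rule dual_ballI)
  show "f \<circ> F \<in> dual_space sX"
    using assms by (auto simp: dual_ball_def dual_space_def intro: bounded_ops_compose)
  fix x
  have "norm (f (F x)) \<le> norm (F x)" by (rule dual_ball_norm_le[OF assms(1)])
  also have "\<dots> \<le> onorm F * norm x" by (rule bounded_ops_norm_le[OF assms(2)])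
  also have "\<dots> \<le> 1 * norm x" by (intro mult_right_mono assms(3)) simp
  finally show "norm ((f \<circ> F) x) \<le> norm x" by simp
qed

text \<open>
  The inequality form avoids the supremum: \<open>\<parallel>x\<parallel>\<close> already bounds all values at \<open>x\<close>, so being
  norming means that no smaller number does.
\<close>

lemma one_norming_iff:
  "one_norming sX \<Gamma> \<longleftrightarrow> \<Gamma> \<noteq> {} \<and> \<Gamma> \<subseteq> dual_ball sX \<and>
    (\<forall>x C. (\<forall>f\<in>\<Gamma>. norm (f x) \<le> C) \<longrightarrow> norm x \<le> C)"
proof (cases "\<Gamma> \<noteq> {} \<and> \<Gamma> \<subseteq> dual_ball sX")
  case True
  have "norm x = (SUP f\<in>\<Gamma>. norm (f x)) \<longleftrightarrow> (\<forall>C. (\<forall>f\<in>\<Gamma>. norm (f x) \<le> C) \<longrightarrow> norm x \<le> C)" for x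
  proof -
    have bnd: "norm (f x) \<le> norm x" if "f \<in> \<Gamma>" for f
      using that True dual_ball_norm_le by blast
    have sup: "(SUP f\<in>\<Gamma>. norm (f x)) \<le> C \<longleftrightarrow> (\<forall>f\<in>\<Gamma>. norm (f x) \<le> C)" for C
      using True bnd by (intro cSUP_le_iff bdd_aboveI2[where M = "norm x"]) auto
    have "(SUP f\<in>\<Gamma>. norm (f x)) \<le> norm x" unfolding sup using bnd by blast
    then show ?thesis unfolding sup[symmetric] by (auto intro: antisym)
  qed
  with True show ?thesis by (auto simp: one_norming_def)
qed (auto simp: one_norming_def)

lemma one_norming_dual_ball:
  assumes "one_norming sX \<Gamma>"
  shows "one_norming sX (dual_ball sX)"
  using assms unfolding one_norming_iff by blast

section \<open>Absolutely convex hulls and the dual distance\<close>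

lemma abs_convex_aco0: "abs_convex (aco0 V)"
  unfolding aco0_def by (rule hull_in) (fastforce simp: abs_convex_def)

lemma aco0_superset: "V \<subseteq> aco0 V"
  unfolding aco0_def by (auto intro: hull_inc)

lemma zero_in_aco0: "(\<lambda>_. 0) \<in> aco0 V"
  unfolding aco0_def by (rule hull_inc) simp

lemma aco0_subset:
  assumes "V \<subseteq> S" "(\<lambda>_. 0) \<in> S" "abs_convex S"
  shows "aco0 V \<subseteq> S"
  unfolding aco0_def using assms by (intro hull_minimal) auto

lemma abs_convexD:
  assumes "abs_convex S" "f \<in> S" "g \<in> S" "norm a + norm b \<le> 1"
  shows "(\<lambda>x. a * f x + b * g x) \<in> S"
  using assms unfolding abs_convex_def by blast

lemma abs_convex_dual_ball:
  fixes sX :: "'k::real_normed_field \<Rightarrow> 'a::real_normed_vector \<Rightarrow> 'a"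
  shows "abs_convex (dual_ball sX)"
  unfolding abs_convex_def
proof (intro ballI allI impI)
  fix f g :: "'a \<Rightarrow> 'k" and a b :: 'k
  assume f: "f \<in> dual_ball sX" and g: "g \<in> dual_ball sX" and ab: "norm a + norm b \<le> 1"
  show "(\<lambda>x. a * f x + b * g x) \<in> dual_ball sX"
  proof (rule dual_ballI)
    show "(\<lambda>x. a * f x + b * g x) \<in> dual_space sX"
      using f g by (auto simp: dual_ball_def intro: dual_space_combination)
    fix x
    have "norm (a * f x + b * g x) \<le> norm a * norm (f x) + norm b * norm (g x)"
      by (metis norm_mult norm_triangle_ineq)
    also have "\<dots> \<le> norm a * norm x + norm b * norm x"
      by (intro add_mono mult_left_mono dual_ball_norm_le[OF f] dual_ball_norm_le[OF g]) auto
    also have "\<dots> = (norm a + norm b) * norm x" by (simp add: algebra_simps)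
    also have "\<dots> \<le> 1 * norm x" by (intro mult_right_mono ab) simp
    finally show "norm (a * f x + b * g x) \<le> norm x" by simp
  qed
qed

lemma zero_in_dual_ball:
  assumes "f \<in> dual_ball sX"
  shows "(\<lambda>_. 0) \<in> dual_ball sX"
  using abs_convexD[OF abs_convex_dual_ball assms assms, of 0 0] by simp

lemma aco0_subset_dual_ball:
  assumes "V \<noteq> {}" "V \<subseteq> dual_ball sX"
  shows "aco0 V \<subseteq> dual_ball sX"
  using assms zero_in_dual_ball by (intro aco0_subset abs_convex_dual_ball) blast+

lemma dual_dist_lessE:
  assumes "f \<in> dual_ball sX" "V \<noteq> {}" "V \<subseteq> dual_ball sX" "dual_dist f (aco0 V) < \<epsilon>"
  obtains g where "g \<in> aco0 V" "g \<in> dual_ball sX" "onorm (\<lambda>x. f x - g x) < \<epsilon>"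
proof -
  have "\<exists>g\<in>aco0 V. onorm (\<lambda>x. f x - g x) < \<epsilon>"
    using assms(4) zero_in_aco0[of V] unfolding dual_dist_def
    by (metis (no_types, lifting) cINF_greatest empty_iff not_le)
  then show thesis using that aco0_subset_dual_ball[OF assms(2,3)] by blast
qed

lemma dual_dist_le:
  assumes "f \<in> dual_ball sX" "A \<subseteq> dual_ball sX" "g \<in> A"
  shows "dual_dist f A \<le> onorm (\<lambda>x. f x - g x)"
  unfolding dual_dist_def
proof (rule cINF_lower[OF bdd_belowI2[where m = 0] assms(3)])
  fix h assume "h \<in> A"
  then have "(\<lambda>x. f x - h x) \<in> dual_space sX"
    using assms(1,2) by (intro dual_space_diff) (auto simp: dual_ball_def)
  then show "0 \<le> onorm (\<lambda>x. f x - h x)"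
    unfolding dual_space_def by (intro onorm_pos_le bounded_ops_linear(1))
qed

lemma openin_weak_star_iff:
  assumes "\<Gamma> \<subseteq> dual_space sX"
  shows "openin (subtopology (weak_star sX) \<Gamma>) U \<longleftrightarrow> (\<exists>W. open W \<and> U = \<Gamma> \<inter> W)"
  using assms by (simp add: weak_star_def subtopology_subtopology inf_absorb2 openin_open)

section \<open>ACK structures\<close>

text \<open>
  The data that an ACK structure provides for one tolerance \<open>\<epsilon>\<close> and one open set \<open>U\<close>.
\<close>

definition ACK_witness where
  "ACK_witness \<rho> sX \<Gamma> \<epsilon> U V x1 e F \<longleftrightarrow>
    V \<noteq> {} \<and> V \<subseteq> U \<and> x1 \<in> V \<and> norm e = 1 \<and> F \<in> bounded_ops sX sX \<and>
    norm (F e) = 1 \<and> onorm F = 1 \<and> x1 (F e) = 1 \<and> x1 \<circ> F = x1 \<and>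
    (\<forall>v\<in>\<Gamma> - ACK_V1 \<Gamma> \<epsilon> F. norm (v (F e)) \<le> \<rho>) \<and>
    (\<forall>f\<in>\<Gamma>. dual_dist (f \<circ> F) (aco0 V) < \<epsilon>) \<and>
    (\<forall>v\<in>V. norm (v e - 1) \<le> \<epsilon>)"

lemma ACK_rho_iff:
  "ACK_rho \<rho> sX \<longleftrightarrow> (\<exists>\<Gamma>. one_norming sX \<Gamma> \<and>
    (\<forall>\<epsilon>>0. \<forall>U. openin (subtopology (weak_star sX) \<Gamma>) U \<and> U \<noteq> {} \<longrightarrow>
      (\<exists>V x1 e F. ACK_witness \<rho> sX \<Gamma> \<epsilon> U V x1 e F)))"
  unfolding ACK_rho_def ACK_structure_def ACK_witness_def ..

text \<open>
  Since \<open>V\<^sub>1 \<subseteq> \<Gamma>\<close>, equality says that \<open>\<Gamma> - V\<^sub>1\<close> is empty; an unsatisfiable bound on this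
  set, such as a norm being at most \<open>-1\<close>, says the same.
\<close>

lemma ACK_eq_ACK_rho: "ACK sX \<longleftrightarrow> ACK_rho (-1) sX"
proof -
  have "ACK_V1 \<Gamma> \<epsilon> F = \<Gamma> \<longleftrightarrow> (\<forall>v\<in>\<Gamma> - ACK_V1 \<Gamma> \<epsilon> F. norm (v u) \<le> -1)"
    for \<Gamma> :: "('b \<Rightarrow> 'a) set" and \<epsilon> F and u :: 'b
  proof -
    have "\<not> norm (v u) \<le> -1" for v :: "'b \<Rightarrow> 'a"
      using norm_ge_zero[of "v u"] by linarith
    then show ?thesis by (auto simp: ACK_V1_def)
  qed
  then show ?thesis by (simp add: ACK_def ACK_rho_def ACK_structure_def)
qed

section \<open>Bounded maps on the injective tensor product\<close>

definition pair_sum :: "('a \<Rightarrow> 'b \<Rightarrow> 'c::monoid_add) \<Rightarrow> ('a \<times> 'b) list \<Rightarrow> 'c"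
  where "pair_sum B zs = (\<Sum>(x, y)\<leftarrow>zs. B x y)"

lemma pair_sum_simps [simp]:
  "pair_sum B [] = 0"
  "pair_sum B ((x, y) # zs) = B x y + pair_sum B zs"
  "pair_sum B (zs @ ws) = pair_sum B zs + pair_sum B ws"
  by (simp_all add: pair_sum_def)

lemma pair_sum_map: "pair_sum B (map (\<lambda>(x, y). (F x, G y)) zs) = pair_sum (\<lambda>x y. B (F x) (G y)) zs"
  by (induction zs) auto

lemma pair_sum_additive:
  assumes "F 0 = 0" "\<And>x y. F (x + y) = F x + F y"
  shows "F (pair_sum B zs) = pair_sum (\<lambda>x y. F (B x y)) zs"
  by (induction zs) (auto simp: assms)

lemma norm_pair_sum_le:
  fixes B :: "_ \<Rightarrow> _ \<Rightarrow> 'c::real_normed_vector"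
  assumes "\<And>x y. norm (B x y) \<le> norm x * norm y"
  shows "norm (pair_sum B zs) \<le> pair_sum (\<lambda>x y. norm x * norm y) zs"
proof (induction zs)
  case (Cons z zs)
  then show ?case
    using assms by (cases z) (auto intro!: norm_triangle_mono)
qed simp

lemma bounded_ops_pair_sum:
  assumes "F \<in> bounded_ops sX sY"
  shows "F (pair_sum B zs) = pair_sum (\<lambda>x y. F (B x y)) zs"
  using bounded_ops_linear(2)[OF assms] linear_0[OF bounded_linear.linear[OF bounded_ops_linear(1)[OF assms]]]
  by (intro pair_sum_additive) auto

lemma dual_space_pair_sum:
  assumes "f \<in> dual_space sX"
  shows "f (pair_sum B zs) = pair_sum (\<lambda>x y. f (B x y)) zs"
  using assms unfolding dual_space_def by (rule bounded_ops_pair_sum)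

definition bilinear_over ::
  "('k::field \<Rightarrow> 'a::ab_group_add \<Rightarrow> 'a) \<Rightarrow> ('k \<Rightarrow> 'b::ab_group_add \<Rightarrow> 'b) \<Rightarrow>
    ('k \<Rightarrow> 'c::ab_group_add \<Rightarrow> 'c) \<Rightarrow> ('a \<Rightarrow> 'b \<Rightarrow> 'c) \<Rightarrow> bool"
  where "bilinear_over sX sY sW B \<longleftrightarrow>
    (\<forall>x. Vector_Spaces.linear sY sW (B x)) \<and> (\<forall>y. Vector_Spaces.linear sX sW (\<lambda>x. B x y))"

lemma pair_sum_scale:
  assumes "bilinear_over sX sY sW B"
  shows "pair_sum B (map (\<lambda>(x, y). (sX c x, y)) zs) = sW c (pair_sum B zs)"
proof -
  have eq: "B (sX c x) y = sW c (B x y)" for x y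
    using assms by (simp add: bilinear_over_def Vector_Spaces.linear_iff)
  interpret vector_space sW using assms by (simp add: bilinear_over_def Vector_Spaces.linear_iff)
  have "sW c (pair_sum B zs) = pair_sum (\<lambda>x y. sW c (B x y)) zs"
    by (intro pair_sum_additive) (auto simp: scale_right_distrib)
  then show ?thesis using pair_sum_map[of B "sX c" "\<lambda>y. y" zs] by (simp add: eq)
qed

text \<open>
  The dual balls are norming by the Hahn--Banach theorem over the scalar field.  Here this is an
  assumption: it is immediate for a space that has an ACK structure, since such a space has a
  norming set (\<open>one_norming_dual_ball\<close>).
\<close>

locale injective_tensor = X: banach_over sX + Y: banach_over sY
  for sX :: "'k::real_normed_field \<Rightarrow> 'a::banach \<Rightarrow> 'a"
    and sY :: "'k \<Rightarrow> 'b::banach \<Rightarrow> 'b"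
    and sZ :: "'k \<Rightarrow> 'c::banach \<Rightarrow> 'c"
    and t :: "'a \<Rightarrow> 'b \<Rightarrow> 'c" +
  assumes tensor: "injective_tensor_product sX sY sZ t"
    and norming_ball_X: "one_norming sX (dual_ball sX)"
    and norming_ball_Y: "one_norming sY (dual_ball sY)"
begin

sublocale Z: banach_over sZ
  using tensor by (simp add: injective_tensor_product_def)

lemma bilinear_t: "bilinear_over sX sY sZ t"
  using tensor by (simp add: injective_tensor_product_def bilinear_over_def)

lemma closure_tensors: "closure (range (pair_sum t)) = UNIV"
  using tensor by (simp add: injective_tensor_product_def pair_sum_def[abs_def])

lemma dense_tensors_induct:
  assumes "closed {z. P z}" "\<And>zs. P (pair_sum t zs)"
  shows "P z"
proof -
  have "closure (range (pair_sum t)) \<subseteq> {z. P z}"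
    using assms by (intro closure_minimal) auto
  then show ?thesis unfolding closure_tensors by blast
qed

lemma pair_sum_dual_eq:
  assumes f: "f \<in> dual_space sX" and g: "g \<in> dual_space sY"
  shows "pair_sum (\<lambda>x y. f x * g y) zs = f (pair_sum (\<lambda>x y. sX (g y) x) zs)"
    and "pair_sum (\<lambda>x y. f x * g y) zs = g (pair_sum (\<lambda>x y. sY (f x) y) zs)"
  by (simp_all add: dual_space_pair_sum[OF f] dual_space_pair_sum[OF g]
      dual_space_linear(3)[OF f] dual_space_linear(3)[OF g] mult.commute)

lemma norm_tensor_eq:
  "norm (pair_sum t zs) =
    (SUP (f, g) \<in> dual_ball sX \<times> dual_ball sY. norm (pair_sum (\<lambda>x y. f x * g y) zs))"
  using tensor by (simp add: injective_tensor_product_def injective_norm_def pair_sum_def)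

lemma functional_le_norm_tensor:
  assumes "f \<in> dual_ball sX" "g \<in> dual_ball sY"
  shows "norm (pair_sum (\<lambda>x y. f x * g y) zs) \<le> norm (pair_sum t zs)"
proof -
  have "bdd_above ((\<lambda>(f, g). norm (pair_sum (\<lambda>x y. f x * g y) zs)) ` (dual_ball sX \<times> dual_ball sY))"
    by (rule bdd_aboveI2[where M = "pair_sum (\<lambda>x y. norm x * norm y) zs"])
      (auto intro!: norm_pair_sum_le mult_mono dual_ball_norm_le simp: norm_mult)
  then show ?thesis
    unfolding norm_tensor_eq using assms by (intro cSUP_upper2[where x = "(f, g)"]) auto
qed

text \<open>
  For fixed \<open>g\<close> the pairing of \<open>f \<otimes> g\<close> with \<open>\<Sum> x\<^sub>i \<otimes> y\<^sub>i\<close> is the value of \<open>f\<close> at the vector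
  \<open>\<Sum> g (y\<^sub>i) x\<^sub>i\<close>, whose norm is detected by \<open>\<Gamma>\<^sub>X\<close>; symmetrically in the other variable.  So a bound
  on \<open>\<Gamma>\<^sub>X \<times> \<Gamma>\<^sub>Y\<close> passes first to \<open>\<Gamma>\<^sub>X \<times> B\<close> and then to the product of both dual balls.
\<close>

lemma norm_tensor_le:
  assumes \<Gamma>X: "one_norming sX \<Gamma>X" and \<Gamma>Y: "one_norming sY \<Gamma>Y"
    and le: "\<And>f g. f \<in> \<Gamma>X \<Longrightarrow> g \<in> \<Gamma>Y \<Longrightarrow> norm (pair_sum (\<lambda>x y. f x * g y) zs) \<le> C"
  shows "norm (pair_sum t zs) \<le> C"
proof -
  have sub: "\<Gamma>X \<subseteq> dual_ball sX" "\<Gamma>Y \<subseteq> dual_ball sY"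
    using \<Gamma>X \<Gamma>Y by (auto simp: one_norming_def)
  note dual = dual_ball_dual_space[of _ sX] and dualY = dual_ball_dual_space[of _ sY]
  have 1: "norm (pair_sum (\<lambda>x y. f x * g y) zs) \<le> C" if f: "f \<in> \<Gamma>X" and g: "g \<in> dual_ball sY" for f g
  proof -
    have "f \<in> dual_space sX" using f sub dual by blast
    note eq = pair_sum_dual_eq(2)[OF this]
    have "norm (g' (pair_sum (\<lambda>x y. sY (f x) y) zs)) \<le> C" if "g' \<in> \<Gamma>Y" for g'
      using le[OF f that] eq[of g' zs] dualY that sub by auto
    then have "norm (pair_sum (\<lambda>x y. sY (f x) y) zs) \<le> C"
      using \<Gamma>Y unfolding one_norming_iff by blast
    with dual_ball_norm_le[OF g] show ?thesis
      unfolding eq[OF dualY[OF g]] by (rule order_trans)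
  qed
  have "norm (pair_sum (\<lambda>x y. f x * g y) zs) \<le> C"
    if f: "f \<in> dual_ball sX" and g: "g \<in> dual_ball sY" for f g
  proof -
    note eq = pair_sum_dual_eq(1)[OF _ dualY[OF g]]
    have "norm (f' (pair_sum (\<lambda>x y. sX (g y) x) zs)) \<le> C" if "f' \<in> \<Gamma>X" for f'
      using 1[OF that g] eq[of f' zs] dual that sub by auto
    then have "norm (pair_sum (\<lambda>x y. sX (g y) x) zs) \<le> C"
      using \<Gamma>X unfolding one_norming_iff by blast
    with dual_ball_norm_le[OF f] show ?thesis
      unfolding eq[OF dual[OF f]] by (rule order_trans)
  qed
  then show ?thesis
    unfolding norm_tensor_eq using norming_ball_X norming_ball_Y
    by (intro cSUP_least) (auto simp: one_norming_def)
qed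

text \<open>
  A bound in terms of the norm of the tensor makes the value independent of the representing list, so
  \<open>B\<close> defines a Lipschitz map on the dense set of finite tensors.  Its continuous extension inherits
  linearity and the bound, as these are closed conditions.
\<close>

lemma extend_bilinear:
  fixes sW :: "'k \<Rightarrow> 'd::banach \<Rightarrow> 'd"
  assumes W: "banach_over sW" and B: "bilinear_over sX sY sW B" and C: "0 \<le> C"
    and bound: "\<And>zs. norm (pair_sum B zs) \<le> C * norm (pair_sum t zs)"
  obtains T where "T \<in> bounded_ops sZ sW" "\<And>x y. T (t x y) = B x y" "onorm T \<le> C"
proof -
  interpret W: banach_over sW by fact
  define rep where "rep z = (SOME zs. pair_sum t zs = z)" for z
  define h where "h z = pair_sum B (rep z)" for z
  have rep: "pair_sum t (rep (pair_sum t zs)) = pair_sum t zs" for zs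
    unfolding rep_def by (rule someI) (rule refl)
  \<comment> \<open>A difference of two finite tensors is again one: append the list with negated first components.\<close>
  have diff: "norm (pair_sum B zs - pair_sum B ws) \<le> C * norm (pair_sum t zs - pair_sum t ws)" for zs ws
    using bound[of "zs @ map (\<lambda>(x, y). (sX (-1) x, y)) ws"]
    using pair_sum_scale[OF B, of "-1" ws] pair_sum_scale[OF bilinear_t, of "-1" ws] by simp
  have h: "h (pair_sum t zs) = pair_sum B zs" for zs
    using diff[of "rep (pair_sum t zs)" zs] by (simp add: h_def rep)
  have "C-lipschitz_on (range (pair_sum t)) h"
    using C diff by (intro lipschitz_onI) (auto simp: h dist_norm)
  then have uc: "uniformly_continuous_on (range (pair_sum t)) h"
    by (rule lipschitz_on_uniformly_continuous)
  obtain T where T: "uniformly_continuous_on UNIV T" "\<And>z. z \<in> range (pair_sum t) \<Longrightarrow> h z = T z"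
    using uniformly_continuous_on_extension_on_closure[OF uc] unfolding closure_tensors by metis
  have TB: "T (pair_sum t zs) = pair_sum B zs" for zs
    using T(2)[of "pair_sum t zs"] h by simp
  have cT: "continuous_on S (\<lambda>x. T (q x))" if "continuous_on S q" for S and q :: "'c \<Rightarrow> 'c"
    using continuous_on_compose2[OF uniformly_continuous_imp_continuous[OF T(1)] that] by simp
  have add: "T (z + w) = T z + T w" for z w
  proof (rule dense_tensors_induct[where z = z])
    show "closed {z. T (z + w) = T z + T w}"
      by (intro closed_Collect_eq continuous_intros cT)
    fix zs
    show "T (pair_sum t zs + w) = T (pair_sum t zs) + T w"
    proof (rule dense_tensors_induct[where z = w])
      show "closed {w. T (pair_sum t zs + w) = T (pair_sum t zs) + T w}"
        by (intro closed_Collect_eq continuous_intros cT)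
      show "T (pair_sum t zs + pair_sum t ws) = T (pair_sum t zs) + T (pair_sum t ws)" for ws
        using TB[of "zs @ ws"] by (simp add: TB)
    qed
  qed
  have scl: "T (sZ c z) = sW c (T z)" for c z
  proof (rule dense_tensors_induct[where z = z])
    show "closed {z. T (sZ c z) = sW c (T z)}"
      by (intro closed_Collect_eq continuous_intros cT Z.continuous_on_scale
          continuous_on_compose2[OF W.continuous_on_scale]) auto
    show "T (sZ c (pair_sum t zs)) = sW c (T (pair_sum t zs))" for zs
      by (metis TB pair_sum_scale[OF B] pair_sum_scale[OF bilinear_t])
  qed
  have bnd: "norm (T z) \<le> C * norm z" for z
  proof (rule dense_tensors_induct[where z = z])
    show "closed {z. norm (T z) \<le> C * norm z}"
      by (intro closed_Collect_le continuous_intros cT)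
  qed (simp add: TB bound)
  show thesis
  proof
    show "T \<in> bounded_ops sZ sW" by (rule Z.bounded_opsI[OF W add scl bnd])
    show "T (t x y) = B x y" for x y using TB[of "[(x, y)]"] by simp
    show "onorm T \<le> C" by (rule onorm_bound[OF C bnd])
  qed
qed

lemma bounded_ops_eqI:
  assumes S: "S \<in> bounded_ops sZ sW" and T: "T \<in> bounded_ops sZ sW"
    and eq: "\<And>x y. S (t x y) = T (t x y)"
  shows "S = T"
proof
  fix z show "S z = T z"
  proof (rule dense_tensors_induct[where z = z])
    show "closed {z. S z = T z}"
      using S T by (intro closed_Collect_eq linear_continuous_on bounded_ops_linear(1))
  qed (simp add: eq bounded_ops_pair_sum[OF S] bounded_ops_pair_sum[OF T])
qed


section \<open>Tensor products of functionals and of operators\<close>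

lemma functional_le_onorm_norm_tensor:
  assumes f: "f \<in> dual_ball sX" and g: "g \<in> dual_space sY"
  shows "norm (pair_sum (\<lambda>x y. f x * g y) zs) \<le> onorm g * norm (pair_sum t zs)"
proof -
  have f': "f \<in> dual_space sX" using f by (simp add: dual_ball_def)
  have bl: "bounded_linear g" using g unfolding dual_space_def by (rule bounded_ops_linear(1))
  show ?thesis
  proof (cases "onorm g = 0")
    case True
    then show ?thesis
      using onorm_eq_0[OF bl] pair_sum_dual_eq(2)[OF f' g] by simp
  next
    case False
    \<comment> \<open>Normalise \<open>g\<close> to a functional in the dual ball.\<close>
    define c :: 'k where "c = of_real (inverse (onorm g))"
    have pos: "onorm g > 0" using False onorm_pos_le[OF bl] by simp
    have norm_c: "norm c = inverse (onorm g)"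
      unfolding c_def norm_of_real using pos by simp
    have cg: "(\<lambda>y. c * g y) \<in> dual_ball sY"
    proof (rule dual_ballI)
      show "(\<lambda>y. c * g y) \<in> dual_space sY"
        using dual_space_combination[OF g g, of c 0] by simp
      show "norm (c * g y) \<le> norm y" for y
        using onorm[OF bl, of y] pos by (simp add: norm_mult norm_c field_simps)
    qed
    then have "(\<lambda>y. c * g y) \<in> dual_space sY" by (simp add: dual_ball_def)
    from pair_sum_dual_eq(2)[OF f' this] pair_sum_dual_eq(2)[OF f' g]
    have "pair_sum (\<lambda>x y. f x * (c * g y)) zs = c * pair_sum (\<lambda>x y. f x * g y) zs"
      by simp
    then show ?thesis
      using functional_le_norm_tensor[OF f cg, of zs] pos
      by (simp add: norm_mult norm_c field_simps)
  qed
qed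

lemma slice_exists:
  assumes g: "g \<in> dual_space sY"
  shows "\<exists>T. T \<in> bounded_ops sZ sX \<and> (\<forall>x y. T (t x y) = sX (g y) x) \<and> onorm T \<le> onorm g"
proof -
  have g': "g \<in> bounded_ops sY (*)" using g by (simp add: dual_space_def)
  have "bilinear_over sX sY sX (\<lambda>x y. sX (g y) x)"
    using X.vector_space_axioms Y.vector_space_axioms
    by (simp add: bilinear_over_def Vector_Spaces.linear_iff bounded_ops_linear(2)[OF g']
        bounded_ops_linear(3)[OF g'] X.scale_left_distrib X.scale_right_distrib mult.commute)
  moreover have "0 \<le> onorm g" by (intro onorm_pos_le bounded_ops_linear(1)[OF g'])
  moreover have "norm (pair_sum (\<lambda>x y. sX (g y) x) zs) \<le> onorm g * norm (pair_sum t zs)" for zs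
  proof -
    have "norm (f (pair_sum (\<lambda>x y. sX (g y) x) zs)) \<le> onorm g * norm (pair_sum t zs)"
      if f: "f \<in> dual_ball sX" for f
      using functional_le_onorm_norm_tensor[OF f g, of zs] pair_sum_dual_eq(1)[OF _ g, of f zs] f
      by (simp add: dual_ball_def)
    then show ?thesis using norming_ball_X unfolding one_norming_iff by blast
  qed
  ultimately show ?thesis
    using extend_bilinear[OF X.banach_over_axioms] by metis
qed

text \<open>
  The map \<open>id \<otimes> g\<close>, identifying \<open>X \<otimes> K\<close> with \<open>X\<close>.  Extending this map to the completion and
  composing it with \<open>f\<close> gives \<open>f \<otimes> g\<close> without extending a scalar-valued map, which would need the
  completeness of the scalar field; that of \<open>X\<close> is at hand.
\<close>

definition slice :: "('b \<Rightarrow> 'k) \<Rightarrow> 'c \<Rightarrow> 'a"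
  where "slice g = (SOME T. T \<in> bounded_ops sZ sX \<and> (\<forall>x y. T (t x y) = sX (g y) x) \<and> onorm T \<le> onorm g)"

definition dual_tensor :: "('a \<Rightarrow> 'k) \<Rightarrow> ('b \<Rightarrow> 'k) \<Rightarrow> 'c \<Rightarrow> 'k"
  where "dual_tensor f g = f \<circ> slice g"

lemma slice:
  assumes "g \<in> dual_space sY"
  shows "slice g \<in> bounded_ops sZ sX" "slice g (t x y) = sX (g y) x" "onorm (slice g) \<le> onorm g"
  using someI_ex[OF slice_exists[OF assms], folded slice_def] by auto

lemma dual_tensor_dual_space:
  assumes "f \<in> dual_space sX" "g \<in> dual_space sY"
  shows "dual_tensor f g \<in> dual_space sZ"
  using assms slice(1) unfolding dual_tensor_def dual_space_def by (blast intro: bounded_ops_compose)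

lemma dual_tensor_apply:
  assumes "f \<in> dual_space sX" "g \<in> dual_space sY"
  shows "dual_tensor f g (t x y) = f x * g y"
  using bounded_ops_linear(3)[OF assms(1)[unfolded dual_space_def]]
  by (simp add: dual_tensor_def slice(2)[OF assms(2)])

lemma onorm_dual_tensor:
  assumes f: "f \<in> dual_space sX" and g: "g \<in> dual_space sY"
  shows "onorm (dual_tensor f g) \<le> onorm f * onorm g"
proof -
  have bl: "bounded_linear f" "bounded_linear (slice g)"
    using bounded_ops_linear(1) f[unfolded dual_space_def] slice(1)[OF g] by blast+
  have "onorm (dual_tensor f g) \<le> onorm f * onorm (slice g)"
    unfolding dual_tensor_def by (rule onorm_compose[OF bl])
  also have "\<dots> \<le> onorm f * onorm g"
    by (intro mult_left_mono slice(3)[OF g] onorm_pos_le bl)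
  finally show ?thesis .
qed

lemma dual_tensor_pair_sum:
  assumes "f \<in> dual_space sX" "g \<in> dual_space sY"
  shows "dual_tensor f g (pair_sum t zs) = pair_sum (\<lambda>x y. f x * g y) zs"
  by (simp add: dual_space_pair_sum[OF dual_tensor_dual_space[OF assms]] dual_tensor_apply[OF assms])

lemma dual_tensor_dual_ball:
  assumes "f \<in> dual_ball sX" "g \<in> dual_ball sY"
  shows "dual_tensor f g \<in> dual_ball sZ"
proof -
  have f: "f \<in> dual_space sX" "onorm f \<le> 1" and g: "g \<in> dual_space sY" "onorm g \<le> 1"
    using assms by (auto simp: dual_ball_def)
  have "0 \<le> onorm g" using g(1) by (intro onorm_pos_le bounded_ops_linear(1)) (simp add: dual_space_def)
  then have "onorm f * onorm g \<le> 1" using f(2) g(2) by (intro mult_le_one)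
  then show ?thesis
    using onorm_dual_tensor[OF f(1) g(1)] dual_tensor_dual_space[OF f(1) g(1)]
    by (simp add: dual_ball_def)
qed

lemma dual_tensor_eqI:
  assumes "f \<in> dual_space sX" "g \<in> dual_space sY" "h \<in> dual_space sZ"
    and "\<And>x y. h (t x y) = f x * g y"
  shows "dual_tensor f g = h"
  using assms dual_tensor_dual_space[OF assms(1,2)] dual_tensor_apply[OF assms(1,2)]
  unfolding dual_space_def by (intro bounded_ops_eqI) auto

lemma dual_tensor_combination_left:
  "dual_tensor (\<lambda>x. a * f x + b * f' x) g = (\<lambda>z. a * dual_tensor f g z + b * dual_tensor f' g z)"
  by (simp add: dual_tensor_def fun_eq_iff)

lemma dual_tensor_combination_right:
  assumes "f \<in> dual_space sX" "g \<in> dual_space sY" "g' \<in> dual_space sY"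
  shows "dual_tensor f (\<lambda>y. a * g y + b * g' y) = (\<lambda>z. a * dual_tensor f g z + b * dual_tensor f g' z)"
  using assms
  by (intro dual_tensor_eqI dual_space_combination dual_tensor_dual_space)
    (auto simp: dual_tensor_apply algebra_simps)

lemma onorm_dual_tensor_diff:
  assumes f: "f \<in> dual_space sX" and f': "f' \<in> dual_space sX"
    and g: "g \<in> dual_space sY" and g': "g' \<in> dual_space sY"
  shows "onorm (\<lambda>z. dual_tensor f g z - dual_tensor f' g' z) \<le>
    onorm (\<lambda>x. f x - f' x) * onorm g + onorm f' * onorm (\<lambda>y. g y - g' y)"
proof -
  have ff: "(\<lambda>x. f x - f' x) \<in> dual_space sX" and gg: "(\<lambda>y. g y - g' y) \<in> dual_space sY"
    using f f' g g' by (auto intro: dual_space_diff)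
  have split: "(\<lambda>z. dual_tensor f g z - dual_tensor f' g' z) =
    (\<lambda>z. dual_tensor (\<lambda>x. f x - f' x) g z + dual_tensor f' (\<lambda>y. g y - g' y) z)"
    using dual_tensor_combination_left[of 1 f "-1" f' g]
      dual_tensor_combination_right[OF f' g g', of 1 "-1"] by simp
  show ?thesis
    unfolding split
    by (intro order_trans[OF onorm_triangle] add_mono onorm_dual_tensor
        dual_space_linear(1)[where sX = sZ] dual_tensor_dual_space f' g ff gg)
qed

text \<open>
  For each fixed \<open>v\<close> in \<open>V\<^sub>Y\<close> the set of \<open>a\<close> with \<open>a \<otimes> v\<close> in the hull is absolutely convex and
  contains \<open>V\<^sub>X\<close> and \<open>0\<close>, so it contains the hull of \<open>V\<^sub>X\<close>.  Then the same argument applies in the second variable.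
\<close>

lemma dual_tensor_aco0:
  assumes VX: "VX \<noteq> {}" "VX \<subseteq> dual_ball sX" and VY: "VY \<noteq> {}" "VY \<subseteq> dual_ball sY"
    and f: "f \<in> aco0 VX" and g: "g \<in> aco0 VY"
  shows "dual_tensor f g \<in> aco0 (case_prod dual_tensor ` (VX \<times> VY))" (is "_ \<in> ?A")
proof -
  have sub: "aco0 VX \<subseteq> dual_ball sX" "aco0 VY \<subseteq> dual_ball sY"
    using aco0_subset_dual_ball VX VY by auto
  have zero: "dual_tensor (\<lambda>_. 0) v = (\<lambda>_. 0)" for v by (simp add: dual_tensor_def o_def)
  have 1: "dual_tensor a v \<in> ?A" if v: "v \<in> VY" and a: "a \<in> aco0 VX" for a v
  proof -
    have "aco0 VX \<subseteq> {a. dual_tensor a v \<in> ?A}"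
    proof (rule aco0_subset)
      show "VX \<subseteq> {a. dual_tensor a v \<in> ?A}"
        using v by (auto intro!: subsetD[OF aco0_superset])
      show "(\<lambda>_. 0) \<in> {a. dual_tensor a v \<in> ?A}" by (simp add: zero zero_in_aco0)
      show "abs_convex {a. dual_tensor a v \<in> ?A}"
        using abs_convexD[OF abs_convex_aco0]
        by (auto simp: abs_convex_def dual_tensor_combination_left)
    qed
    with a show ?thesis by blast
  qed
  have fs: "f \<in> dual_space sX" using f sub by (auto simp: dual_ball_def)
  \<comment> \<open>Additivity in the second variable needs bounded functionals, hence the restriction to the ball.\<close>
  have "aco0 VY \<subseteq> {b \<in> dual_ball sY. dual_tensor f b \<in> ?A}"
  proof (rule aco0_subset)
    show "VY \<subseteq> {b \<in> dual_ball sY. dual_tensor f b \<in> ?A}" using VY(2) 1[OF _ f] by blast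
    obtain v where v: "v \<in> VY" using VY(1) by blast
    then have vs: "v \<in> dual_space sY" using VY(2) by (auto simp: dual_ball_def)
    have "dual_tensor f (\<lambda>_. 0) = (\<lambda>_. 0)"
      using dual_tensor_combination_right[OF fs vs vs, of 0 0] by simp
    then show "(\<lambda>_. 0) \<in> {b \<in> dual_ball sY. dual_tensor f b \<in> ?A}"
      using zero_in_dual_ball v VY(2) by (auto simp: zero_in_aco0)
    show "abs_convex {b \<in> dual_ball sY. dual_tensor f b \<in> ?A}"
      unfolding abs_convex_def
    proof (intro ballI allI impI)
      fix b b' p q
      assume b: "b \<in> {b \<in> dual_ball sY. dual_tensor f b \<in> ?A}"
        and b': "b' \<in> {b \<in> dual_ball sY. dual_tensor f b \<in> ?A}"
        and pq: "norm (p::'k) + norm (q::'k) \<le> 1"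
      have "b \<in> dual_space sY" "b' \<in> dual_space sY" using b b' by (auto simp: dual_ball_def)
      then show "(\<lambda>x. p * b x + q * b' x) \<in> {b \<in> dual_ball sY. dual_tensor f b \<in> ?A}"
        using b b' by (simp add: dual_tensor_combination_right[OF fs]
            abs_convexD[OF abs_convex_dual_ball _ _ pq] abs_convexD[OF abs_convex_aco0 _ _ pq])
    qed
  qed
  with g show ?thesis by blast
qed

lemma norm_t: "norm (t x y) = norm x * norm y"
proof (rule antisym)
  have "norm (pair_sum t [(x, y)]) \<le> norm x * norm y"
    by (rule norm_tensor_le[OF norming_ball_X norming_ball_Y])
      (auto simp: norm_mult intro!: mult_mono dual_ball_norm_le)
  then show "norm (t x y) \<le> norm x * norm y" by simp
  have fg: "norm (f x) * norm (g y) \<le> norm (t x y)" if "f \<in> dual_ball sX" "g \<in> dual_ball sY" for f g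
    using functional_le_norm_tensor[OF that, of "[(x, y)]"] by (simp add: norm_mult)
  have g: "norm x * norm (g y) \<le> norm (t x y)" if g: "g \<in> dual_ball sY" for g
  proof -
    have "norm (f (sX (g y) x)) \<le> norm (t x y)" if f: "f \<in> dual_ball sX" for f
      using fg[OF f g] by (simp add: dual_space_linear(3)[OF dual_ball_dual_space[OF f]] norm_mult mult.commute)
    then have "norm (sX (g y) x) \<le> norm (t x y)"
      using norming_ball_X unfolding one_norming_iff by blast
    then show ?thesis by (simp add: X.norm_scale mult.commute)
  qed
  \<comment> \<open>Absorb the number \<open>\<parallel>x\<parallel>\<close> into the vector \<open>y\<close>, so that the norming property applies again.\<close>
  have "norm (g (sY (of_real (norm x)) y)) \<le> norm (t x y)" if "g \<in> dual_ball sY" for g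
    using g[OF that] by (simp add: dual_space_linear(3)[OF dual_ball_dual_space[OF that]] norm_mult)
  then have "norm (sY (of_real (norm x)) y) \<le> norm (t x y)"
    using norming_ball_Y unfolding one_norming_iff by blast
  then show "norm x * norm y \<le> norm (t x y)" by (simp add: Y.norm_scale)
qed

text \<open>
  Pairing \<open>f \<otimes> g\<close> with \<open>\<Sum> F x\<^sub>i \<otimes> G y\<^sub>i\<close> is pairing \<open>(f \<circ> F) \<otimes> (g \<circ> G)\<close> with the original tensor,
  and adjoints of contractions preserve the dual balls; so \<open>F \<otimes> G\<close> is a contraction.
\<close>

lemma operator_tensor_exists:
  assumes F: "F \<in> bounded_ops sX sX" "onorm F \<le> 1" and G: "G \<in> bounded_ops sY sY" "onorm G \<le> 1"
  obtains T where "T \<in> bounded_ops sZ sZ" "\<And>x y. T (t x y) = t (F x) (G y)" "onorm T \<le> 1"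
proof (rule extend_bilinear[OF Z.banach_over_axioms])
  show "bilinear_over sX sY sZ (\<lambda>x y. t (F x) (G y))"
    using bilinear_t F(1) G(1) by (auto simp: bilinear_over_def bounded_ops_def Vector_Spaces.linear_iff)
  show "norm (pair_sum (\<lambda>x y. t (F x) (G y)) zs) \<le> 1 * norm (pair_sum t zs)" for zs
  proof -
    have "norm (pair_sum t (map (\<lambda>(x, y). (F x, G y)) zs)) \<le> norm (pair_sum t zs)"
    proof (rule norm_tensor_le[OF norming_ball_X norming_ball_Y])
      fix f g assume "f \<in> dual_ball sX" "g \<in> dual_ball sY"
      then have "f \<circ> F \<in> dual_ball sX" "g \<circ> G \<in> dual_ball sY"
        using F G by (auto intro: dual_ball_compose)
      from functional_le_norm_tensor[OF this, of zs]
      show "norm (pair_sum (\<lambda>x y. f x * g y) (map (\<lambda>(x, y). (F x, G y)) zs)) \<le> norm (pair_sum t zs)"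
        by (simp add: pair_sum_map)
    qed
    then show ?thesis by (simp add: pair_sum_map)
  qed
qed (use that in auto)

section \<open>The norming set of tensor functionals and its weak-star topology\<close>

lemma tensors_approx:
  assumes "e > 0"
  obtains zs where "norm (z - pair_sum t zs) < e"
proof -
  have "z \<in> closure (range (pair_sum t))" by (simp add: closure_tensors)
  then show thesis
    using assms that unfolding closure_approachable by (auto simp: dist_norm norm_minus_commute)
qed

lemma one_norming_dual_tensor:
  assumes \<Gamma>X: "one_norming sX \<Gamma>X" and \<Gamma>Y: "one_norming sY \<Gamma>Y"
  shows "one_norming sZ (case_prod dual_tensor ` (\<Gamma>X \<times> \<Gamma>Y))"
  unfolding one_norming_iff
proof (intro conjI allI impI)
  have sub: "\<Gamma>X \<subseteq> dual_ball sX" "\<Gamma>Y \<subseteq> dual_ball sY"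
    using \<Gamma>X \<Gamma>Y by (auto simp: one_norming_def)
  show "case_prod dual_tensor ` (\<Gamma>X \<times> \<Gamma>Y) \<noteq> {}"
    using \<Gamma>X \<Gamma>Y by (auto simp: one_norming_def)
  show "case_prod dual_tensor ` (\<Gamma>X \<times> \<Gamma>Y) \<subseteq> dual_ball sZ"
    using sub by (auto intro: dual_tensor_dual_ball)
  fix z C assume le: "\<forall>h\<in>case_prod dual_tensor ` (\<Gamma>X \<times> \<Gamma>Y). norm (h z) \<le> C"
  show "norm z \<le> C"
  proof (rule field_le_epsilon)
    fix e :: real assume "e > 0"
    then obtain zs where zs: "norm (z - pair_sum t zs) < e / 2"
      using tensors_approx[of "e / 2"] by auto
    have "norm (pair_sum t zs) \<le> C + e / 2"
    proof (rule norm_tensor_le[OF \<Gamma>X \<Gamma>Y])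
      fix f g assume f: "f \<in> \<Gamma>X" and g: "g \<in> \<Gamma>Y"
      then have fg: "f \<in> dual_ball sX" "g \<in> dual_ball sY" using sub by auto
      then have d: "f \<in> dual_space sX" "g \<in> dual_space sY" by (auto simp: dual_ball_def)
      let ?h = "dual_tensor f g"
      have "?h z = ?h (z - pair_sum t zs) + ?h (pair_sum t zs)"
        using bounded_ops_linear(2)[OF dual_tensor_dual_space[OF d, unfolded dual_space_def],
            of "z - pair_sum t zs" "pair_sum t zs"] by simp
      then have "norm (?h (pair_sum t zs)) \<le> norm (?h z) + norm (?h (z - pair_sum t zs))"
        by (metis add_diff_cancel_left' norm_triangle_ineq4)
      also have "\<dots> \<le> C + e / 2"
        using dual_ball_norm_le[OF dual_tensor_dual_ball[OF fg], of "z - pair_sum t zs"] zs le f g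
        by fastforce
      finally show "norm (pair_sum (\<lambda>x y. f x * g y) zs) \<le> C + e / 2"
        by (simp add: dual_tensor_pair_sum[OF d])
    qed
    then show "norm z \<le> C + e"
      using zs norm_triangle_sub[of z "pair_sum t zs"] by simp
  qed
qed

text \<open>
  Evaluation of \<open>f \<otimes> g\<close> at a finite tensor is a polynomial in values of \<open>f\<close> and \<open>g\<close>.  Since all
  \<open>f \<otimes> g\<close> have norm at most 1, evaluation at a general point is a uniform limit of such functions.
\<close>

lemma continuous_on_dual_tensor:
  assumes sub: "\<Gamma>X \<subseteq> dual_ball sX" "\<Gamma>Y \<subseteq> dual_ball sY"
  shows "continuous_on (\<Gamma>X \<times> \<Gamma>Y) (\<lambda>p. dual_tensor (fst p) (snd p))"
proof (rule continuous_on_coordinatewise_then_product)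
  fix z
  have "\<forall>n. \<exists>zs. norm (z - pair_sum t zs) < inverse (real (Suc n))"
    using tensors_approx by (metis inverse_positive_iff_positive of_nat_0_less_iff zero_less_Suc)
  then obtain zs where zs: "\<And>n. norm (z - pair_sum t (zs n)) < inverse (real (Suc n))"
    by metis
  have coord: "continuous_on S (\<lambda>p :: ('a \<Rightarrow> 'k) \<times> ('b \<Rightarrow> 'k). fst p x)"
    "continuous_on S (\<lambda>p :: ('a \<Rightarrow> 'k) \<times> ('b \<Rightarrow> 'k). snd p y)" for S x y
    by (rule continuous_on_product_then_coordinatewise, intro continuous_intros)+
  have cont_sum: "continuous_on (\<Gamma>X \<times> \<Gamma>Y) (\<lambda>p. pair_sum (\<lambda>x y. fst p x * snd p y) ws)" for ws
    by (induction ws) (auto intro!: continuous_intros coord)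
  have cont: "continuous_on (\<Gamma>X \<times> \<Gamma>Y) (\<lambda>p. dual_tensor (fst p) (snd p) (pair_sum t ws))" for ws
    by (rule continuous_on_eq[OF cont_sum[of ws]])
      (use sub in \<open>auto intro!: dual_tensor_pair_sum[symmetric] dual_ball_dual_space\<close>)
  have "uniform_limit (\<Gamma>X \<times> \<Gamma>Y) (\<lambda>n p. dual_tensor (fst p) (snd p) (pair_sum t (zs n)))
    (\<lambda>p. dual_tensor (fst p) (snd p) z) sequentially"
  proof (rule uniform_limitI)
    fix e :: real assume "e > 0"
    then have "\<forall>\<^sub>F n in sequentially. inverse (real (Suc n)) < e"
      using order_tendstoD(2)[OF LIMSEQ_inverse_real_of_nat] by blast
    then show "\<forall>\<^sub>F n in sequentially. \<forall>p\<in>\<Gamma>X \<times> \<Gamma>Y.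
      dist (dual_tensor (fst p) (snd p) (pair_sum t (zs n))) (dual_tensor (fst p) (snd p) z) < e"
    proof eventually_elim
      case (elim n)
      show ?case
      proof
        fix p assume "p \<in> \<Gamma>X \<times> \<Gamma>Y"
        then have h: "dual_tensor (fst p) (snd p) \<in> dual_ball sZ"
          using sub by (intro dual_tensor_dual_ball) auto
        let ?h = "dual_tensor (fst p) (snd p)"
        have bl: "bounded_linear ?h"
          by (rule dual_space_linear(1)[OF dual_ball_dual_space[OF h]])
        have "dist (?h (pair_sum t (zs n))) (?h z) = norm (?h (z - pair_sum t (zs n)))"
          by (simp add: dist_norm norm_minus_commute linear_diff[OF bounded_linear.linear[OF bl]])
        then show "dist (?h (pair_sum t (zs n))) (?h z) < e"
          using dual_ball_norm_le[OF h, of "z - pair_sum t (zs n)"] zs[of n] elim by linarith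
      qed
    qed
  qed
  with always_eventually[OF allI[OF cont]]
  show "continuous_on (\<Gamma>X \<times> \<Gamma>Y) (\<lambda>p. dual_tensor (fst p) (snd p) z)"
    by (rule uniform_limit_theorem) simp
qed

lemma weak_star_open_rectangle:
  assumes sub: "\<Gamma>X \<subseteq> dual_ball sX" "\<Gamma>Y \<subseteq> dual_ball sY"
    and U: "openin (subtopology (weak_star sZ) (case_prod dual_tensor ` (\<Gamma>X \<times> \<Gamma>Y))) U" "U \<noteq> {}"
  obtains UX UY where
    "openin (subtopology (weak_star sX) \<Gamma>X) UX" "UX \<noteq> {}"
    "openin (subtopology (weak_star sY) \<Gamma>Y) UY" "UY \<noteq> {}"
    "case_prod dual_tensor ` (UX \<times> UY) \<subseteq> U"
proof -
  let ?T = "\<lambda>p. dual_tensor (fst p) (snd p)"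
  have dual: "\<Gamma>X \<subseteq> dual_space sX" "\<Gamma>Y \<subseteq> dual_space sY"
    "case_prod dual_tensor ` (\<Gamma>X \<times> \<Gamma>Y) \<subseteq> dual_space sZ"
    using sub dual_tensor_dual_ball by (auto intro!: dual_ball_dual_space)
  obtain W where W: "open W" "U = case_prod dual_tensor ` (\<Gamma>X \<times> \<Gamma>Y) \<inter> W"
    using U(1) unfolding openin_weak_star_iff[OF dual(3)] by blast
  obtain p where p: "p \<in> \<Gamma>X \<times> \<Gamma>Y" "?T p \<in> W" using U(2) W(2) by fastforce
  obtain A where A: "open A" "A \<inter> (\<Gamma>X \<times> \<Gamma>Y) = ?T -` W \<inter> (\<Gamma>X \<times> \<Gamma>Y)"
    using continuous_on_dual_tensor[OF sub] W(1) unfolding continuous_on_open_invariant by blast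
  have "p \<in> A" using A(2) p by blast
  then obtain B C where BC: "open B" "open C" "p \<in> B \<times> C" "B \<times> C \<subseteq> A"
    using open_prod_elim[OF A(1)] by metis
  show thesis
  proof (rule that[of "\<Gamma>X \<inter> B" "\<Gamma>Y \<inter> C"])
    show "openin (subtopology (weak_star sX) \<Gamma>X) (\<Gamma>X \<inter> B)"
      "openin (subtopology (weak_star sY) \<Gamma>Y) (\<Gamma>Y \<inter> C)"
      using BC(1,2) openin_weak_star_iff dual by blast+
    show "\<Gamma>X \<inter> B \<noteq> {}" "\<Gamma>Y \<inter> C \<noteq> {}" using p(1) BC(3) by auto
    show "case_prod dual_tensor ` ((\<Gamma>X \<inter> B) \<times> (\<Gamma>Y \<inter> C)) \<subseteq> U"
    proof clarify
      fix f g assume fg: "f \<in> \<Gamma>X" "f \<in> B" "g \<in> \<Gamma>Y" "g \<in> C"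
      then have "(f, g) \<in> A \<inter> (\<Gamma>X \<times> \<Gamma>Y)" using BC(4) by blast
      then have "dual_tensor f g \<in> W" unfolding A(2) by simp
      then show "dual_tensor f g \<in> U" using fg W(2) by auto
    qed
  qed
qed

section \<open>ACK structures pass to the tensor product\<close>

lemma dual_tensor_compose:
  assumes f: "f \<in> dual_ball sX" and F: "F \<in> bounded_ops sX sX" "onorm F \<le> 1"
    and g: "g \<in> dual_ball sY" and G: "G \<in> bounded_ops sY sY" "onorm G \<le> 1"
    and T: "T \<in> bounded_ops sZ sZ" "\<And>x y. T (t x y) = t (F x) (G y)"
  shows "dual_tensor f g \<circ> T = dual_tensor (f \<circ> F) (g \<circ> G)"
proof (rule dual_tensor_eqI[symmetric])
  show "f \<circ> F \<in> dual_space sX" "g \<circ> G \<in> dual_space sY"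
    using dual_ball_compose f F g G by (blast intro: dual_ball_dual_space)+
  have d: "dual_tensor f g \<in> dual_space sZ"
    using f g by (intro dual_tensor_dual_space dual_ball_dual_space)
  then show "dual_tensor f g \<circ> T \<in> dual_space sZ"
    using T(1) unfolding dual_space_def by (blast intro: bounded_ops_compose)
  show "(dual_tensor f g \<circ> T) (t x y) = (f \<circ> F) x * (g \<circ> G) y" for x y
    using f g by (simp add: T(2) dual_tensor_apply dual_ball_dual_space)
qed

text \<open>
  With \<open>a\<close>, \<open>b\<close> the norms of the adjoint images and \<open>p\<close>, \<open>q\<close> those of the remainders, the
  hypotheses say \<open>(1 - \<delta>) p \<le> 1 - a\<close> and \<open>(1 - \<delta>) q \<le> 1 - b\<close>.  The remainder of
  \<open>f \<otimes> g\<close> has norm at most \<open>p + a q\<close>, and \<open>(1 - a) + a (1 - b) = 1 - a b\<close>.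
\<close>

lemma ACK_V1_dual_tensor:
  assumes sub: "\<Gamma>X \<subseteq> dual_ball sX" "\<Gamma>Y \<subseteq> dual_ball sY"
    and F: "F \<in> bounded_ops sX sX" "onorm F \<le> 1"
    and G: "G \<in> bounded_ops sY sY" "onorm G \<le> 1"
    and T: "T \<in> bounded_ops sZ sZ" "\<And>x y. T (t x y) = t (F x) (G y)"
    and \<delta>: "\<delta> \<le> 1" "\<delta> \<le> \<epsilon>"
    and f: "f \<in> ACK_V1 \<Gamma>X \<delta> F" and g: "g \<in> ACK_V1 \<Gamma>Y \<delta> G"
  shows "dual_tensor f g \<in> ACK_V1 (case_prod dual_tensor ` (\<Gamma>X \<times> \<Gamma>Y)) \<epsilon> T"
proof -
  have fb: "f \<in> dual_ball sX" "f \<circ> F \<in> dual_ball sX" and gb: "g \<in> dual_ball sY" "g \<circ> G \<in> dual_ball sY"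
    using f g sub F G by (auto simp: ACK_V1_def intro!: dual_ball_compose)
  note fd = fb[THEN dual_ball_dual_space] and gd = gb[THEN dual_ball_dual_space]
  define a where "a = onorm (f \<circ> F)"
  define b where "b = onorm (g \<circ> G)"
  define p where "p = onorm (\<lambda>x. f x - (f \<circ> F) x)"
  define q where "q = onorm (\<lambda>y. g y - (g \<circ> G) y)"
  define d where "d = onorm (\<lambda>z. dual_tensor f g z - (dual_tensor f g \<circ> T) z)"
  have nonneg: "0 \<le> a" "0 \<le> b" "0 \<le> p" "0 \<le> q" "0 \<le> d"
    unfolding a_def b_def p_def q_def d_def dual_tensor_compose[OF fb(1) F gb(1) G T]
    using onorm_dual_space_nonneg[OF fd(2)] onorm_dual_space_nonneg[OF gd(2)]
      onorm_dual_space_nonneg[OF dual_space_diff[OF fd]] onorm_dual_space_nonneg[OF dual_space_diff[OF gd]]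
      onorm_dual_space_nonneg[OF dual_space_diff[OF dual_tensor_dual_space dual_tensor_dual_space], OF fd(1) gd(1) fd(2) gd(2)]
    by auto
  have fV: "a + (1 - \<delta>) * p \<le> 1" and gV: "b + (1 - \<delta>) * q \<le> 1"
    using f g by (auto simp: ACK_V1_def a_def b_def p_def q_def)
  have "d \<le> p * onorm g + a * q"
    unfolding a_def p_def q_def d_def dual_tensor_compose[OF fb(1) F gb(1) G T]
    by (rule onorm_dual_tensor_diff[OF fd gd])
  also have "p * onorm g \<le> p * 1"
    using gb(1) nonneg by (intro mult_left_mono) (auto simp: dual_ball_def)
  finally have d: "d \<le> p + a * q" by simp
  have "(1 - \<epsilon>) * d \<le> (1 - \<delta>) * d" using \<delta> nonneg by (intro mult_right_mono) auto
  also have "\<dots> \<le> (1 - \<delta>) * (p + a * q)" using d \<delta> by (intro mult_left_mono) auto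
  also have "\<dots> = (1 - \<delta>) * p + a * ((1 - \<delta>) * q)" by (simp add: algebra_simps)
  also have "\<dots> \<le> (1 - a) + a * (1 - b)"
    using fV gV nonneg by (intro add_mono mult_left_mono) auto
  finally have "a * b + (1 - \<epsilon>) * d \<le> 1" by (simp add: algebra_simps)
  moreover have "onorm (dual_tensor f g \<circ> T) \<le> a * b"
    unfolding a_def b_def dual_tensor_compose[OF fb(1) F gb(1) G T]
    by (rule onorm_dual_tensor[OF fd(2) gd(2)])
  moreover have "f \<in> \<Gamma>X" "g \<in> \<Gamma>Y" using f g by (auto simp: ACK_V1_def)
  ultimately show ?thesis by (auto simp: ACK_V1_def d_def)
qed

text \<open>
  The distance and the deviation of \<open>v (e)\<close> from \<open>1\<close> both add up over the factors, whence
  \<open>\<delta> \<le> \<epsilon> / 2\<close>; the estimate of \<open>V\<^sub>1\<close> multiplies inequalities by \<open>1 - \<delta>\<close>, whence the cap that keeps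
  \<open>\<delta>\<close> below \<open>1\<close> when \<open>\<epsilon>\<close> is large.
\<close>

lemma ACK_witness_tensor:
  assumes sub: "\<Gamma>X \<subseteq> dual_ball sX" "\<Gamma>Y \<subseteq> dual_ball sY"
    and \<epsilon>: "\<epsilon> > 0" and \<delta>: "\<delta> = min (\<epsilon> / 2) (1 / 2)"
    and WX: "ACK_witness \<rho> sX \<Gamma>X \<delta> UX VX f1 eX F" and UX: "UX \<subseteq> \<Gamma>X"
    and WY: "ACK_witness \<rho> sY \<Gamma>Y \<delta> UY VY g1 eY G" and UY: "UY \<subseteq> \<Gamma>Y"
    and U: "case_prod dual_tensor ` (UX \<times> UY) \<subseteq> U"
  shows "\<exists>T. ACK_witness \<rho> sZ (case_prod dual_tensor ` (\<Gamma>X \<times> \<Gamma>Y)) \<epsilon> U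
    (case_prod dual_tensor ` (VX \<times> VY)) (dual_tensor f1 g1) (t eX eY) T"
proof -
  have X: "VX \<noteq> {}" "VX \<subseteq> UX" "f1 \<in> VX" "norm eX = 1" "F \<in> bounded_ops sX sX"
    "norm (F eX) = 1" "onorm F = 1" "f1 (F eX) = 1" "f1 \<circ> F = f1"
    and X4: "\<And>v. v \<in> \<Gamma>X - ACK_V1 \<Gamma>X \<delta> F \<Longrightarrow> norm (v (F eX)) \<le> \<rho>"
    and X5: "\<And>f. f \<in> \<Gamma>X \<Longrightarrow> dual_dist (f \<circ> F) (aco0 VX) < \<delta>"
    and X6: "\<And>v. v \<in> VX \<Longrightarrow> norm (v eX - 1) \<le> \<delta>"
    using WX by (auto simp: ACK_witness_def)
  have Y: "VY \<noteq> {}" "VY \<subseteq> UY" "g1 \<in> VY" "norm eY = 1" "G \<in> bounded_ops sY sY"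
    "norm (G eY) = 1" "onorm G = 1" "g1 (G eY) = 1" "g1 \<circ> G = g1"
    and Y4: "\<And>v. v \<in> \<Gamma>Y - ACK_V1 \<Gamma>Y \<delta> G \<Longrightarrow> norm (v (G eY)) \<le> \<rho>"
    and Y5: "\<And>g. g \<in> \<Gamma>Y \<Longrightarrow> dual_dist (g \<circ> G) (aco0 VY) < \<delta>"
    and Y6: "\<And>v. v \<in> VY \<Longrightarrow> norm (v eY - 1) \<le> \<delta>"
    using WY by (auto simp: ACK_witness_def)
  have F1: "onorm F \<le> 1" and G1: "onorm G \<le> 1" using X(7) Y(7) by auto
  obtain T where T: "T \<in> bounded_ops sZ sZ" "\<And>x y. T (t x y) = t (F x) (G y)" "onorm T \<le> 1"
    using operator_tensor_exists[OF X(5) F1 Y(5) G1] by blast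
  have \<delta>': "\<delta> > 0" "2 * \<delta> \<le> \<epsilon>" "\<delta> \<le> 1" "\<delta> \<le> \<epsilon>" using \<epsilon> \<delta> by auto
  have VX: "VX \<subseteq> dual_ball sX" and VY: "VY \<subseteq> dual_ball sY"
    using X(2) UX Y(2) UY sub by auto
  let ?\<Gamma> = "case_prod dual_tensor ` (\<Gamma>X \<times> \<Gamma>Y)" and ?V = "case_prod dual_tensor ` (VX \<times> VY)"
  note adj = dual_tensor_compose[OF _ X(5) F1 _ Y(5) G1 T(1,2)]
  have ap: "dual_tensor f g (t x y) = f x * g y" if "f \<in> dual_ball sX" "g \<in> dual_ball sY" for f g x y
    using that by (simp add: dual_tensor_apply dual_ball_dual_space)
  have nT: "norm (T (t eX eY)) = 1" by (simp add: T(2) norm_t X(6) Y(6))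
  have onormT: "onorm T = 1"
  proof (rule antisym[OF T(3)])
    show "1 \<le> onorm T"
      using bounded_ops_norm_le[OF T(1), of "t eX eY"] by (simp add: nT norm_t X(4) Y(4))
  qed
  have fixed: "dual_tensor f1 g1 (T (t eX eY)) = 1" "dual_tensor f1 g1 \<circ> T = dual_tensor f1 g1"
    using X(3) Y(3) VX VY by (auto simp: T(2) ap X(8) Y(8) adj X(9) Y(9) subsetD)
  have small: "norm (v (T (t eX eY))) \<le> \<rho>" if v: "v \<in> ?\<Gamma> - ACK_V1 ?\<Gamma> \<epsilon> T" for v
  proof -
    obtain f g where fg: "f \<in> \<Gamma>X" "g \<in> \<Gamma>Y" "v = dual_tensor f g" using v by auto
    then have fb: "f \<in> dual_ball sX" and gb: "g \<in> dual_ball sY" using sub by auto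
    have le1: "norm (f (F eX)) \<le> 1" "norm (g (G eY)) \<le> 1"
      using dual_ball_norm_le[OF fb, of "F eX"] dual_ball_norm_le[OF gb, of "G eY"] X(6) Y(6) by auto
    have "f \<notin> ACK_V1 \<Gamma>X \<delta> F \<or> g \<notin> ACK_V1 \<Gamma>Y \<delta> G"
      using ACK_V1_dual_tensor[OF sub X(5) F1 Y(5) G1 T(1,2) \<delta>'(3,4), of f g] v fg(3) by auto
    then show ?thesis
    proof
      assume "f \<notin> ACK_V1 \<Gamma>X \<delta> F"
      then have "norm (f (F eX)) \<le> \<rho>" using X4 fg(1) by blast
      moreover have "norm (f (F eX)) * norm (g (G eY)) \<le> norm (f (F eX))"
        using le1(2) by (intro mult_left_le) auto
      ultimately show ?thesis by (simp add: fg(3) T(2) ap[OF fb gb] norm_mult)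
    next
      assume "g \<notin> ACK_V1 \<Gamma>Y \<delta> G"
      then have "norm (g (G eY)) \<le> \<rho>" using Y4 fg(2) by blast
      moreover have "norm (f (F eX)) * norm (g (G eY)) \<le> norm (g (G eY))"
        using le1(1) by (intro mult_left_le_one_le) auto
      ultimately show ?thesis by (simp add: fg(3) T(2) ap[OF fb gb] norm_mult)
    qed
  qed
  have close: "dual_dist (h \<circ> T) (aco0 ?V) < \<epsilon>" if h: "h \<in> ?\<Gamma>" for h
  proof -
    obtain f g where fg: "f \<in> \<Gamma>X" "g \<in> \<Gamma>Y" "h = dual_tensor f g" using h by auto
    then have fb: "f \<in> dual_ball sX" and gb: "g \<in> dual_ball sY" using sub by auto
    have fF: "f \<circ> F \<in> dual_ball sX" and gG: "g \<circ> G \<in> dual_ball sY"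
      using dual_ball_compose fb X(5) F1 gb Y(5) G1 by blast+
    obtain a where a: "a \<in> aco0 VX" "a \<in> dual_ball sX" "onorm (\<lambda>x. (f \<circ> F) x - a x) < \<delta>"
      using dual_dist_lessE[OF fF X(1) VX X5[OF fg(1)]] by blast
    obtain b where b: "b \<in> aco0 VY" "b \<in> dual_ball sY" "onorm (\<lambda>y. (g \<circ> G) y - b y) < \<delta>"
      using dual_dist_lessE[OF gG Y(1) VY Y5[OF fg(2)]] by blast
    have V: "?V \<noteq> {}" "?V \<subseteq> dual_ball sZ"
      using X(1) Y(1) VX VY by (auto intro: dual_tensor_dual_ball)
    have "dual_dist (h \<circ> T) (aco0 ?V) \<le> onorm (\<lambda>z. (h \<circ> T) z - dual_tensor a b z)"
      unfolding fg(3) adj[OF fb gb]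
      by (intro dual_dist_le[where sX = sZ] dual_tensor_dual_ball fF gG aco0_subset_dual_ball V
          dual_tensor_aco0 X(1) VX Y(1) VY a(1) b(1))
    also have "\<dots> \<le> onorm (\<lambda>x. (f \<circ> F) x - a x) * onorm (g \<circ> G) + onorm a * onorm (\<lambda>y. (g \<circ> G) y - b y)"
      unfolding fg(3) adj[OF fb gb]
      by (intro onorm_dual_tensor_diff dual_ball_dual_space fF gG a(2) b(2))
    also have "\<dots> \<le> onorm (\<lambda>x. (f \<circ> F) x - a x) * 1 + 1 * onorm (\<lambda>y. (g \<circ> G) y - b y)"
    proof (intro add_mono mult_left_mono mult_right_mono)
      show "onorm (g \<circ> G) \<le> 1" "onorm a \<le> 1" using gG a(2) by (auto simp: dual_ball_def)
      show "0 \<le> onorm (\<lambda>x. (f \<circ> F) x - a x)" "0 \<le> onorm (\<lambda>y. (g \<circ> G) y - b y)"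
        using fF gG a(2) b(2)
        by (metis dual_ball_dual_space dual_space_diff onorm_dual_space_nonneg)+
    qed
    also have "\<dots> < \<epsilon>" using a(3) b(3) \<delta>'(2) by linarith
    finally show ?thesis .
  qed
  have near1: "norm (v (t eX eY) - 1) \<le> \<epsilon>" if v: "v \<in> ?V" for v
  proof -
    obtain f g where fg: "f \<in> VX" "g \<in> VY" "v = dual_tensor f g" using v by auto
    then have fb: "f \<in> dual_ball sX" and gb: "g \<in> dual_ball sY" using VX VY by auto
    have "v (t eX eY) - 1 = (f eX - 1) * g eY + (g eY - 1)"
      by (simp add: fg(3) ap[OF fb gb] algebra_simps)
    then have "norm (v (t eX eY) - 1) \<le> norm (f eX - 1) * norm (g eY) + norm (g eY - 1)"
      by (metis norm_mult norm_triangle_ineq)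
    also have "\<dots> \<le> \<delta> * 1 + \<delta>"
      using X6[OF fg(1)] Y6[OF fg(2)] dual_ball_norm_le[OF gb, of eY] Y(4) \<delta>'(1)
      by (intro add_mono mult_mono) auto
    finally show ?thesis using \<delta>'(2) by simp
  qed
  have V: "?V \<noteq> {}" "?V \<subseteq> U" "dual_tensor f1 g1 \<in> ?V" "norm (t eX eY) = 1"
    using X(1-4) Y(1-4) U by (auto simp: norm_t)
  show ?thesis
    unfolding ACK_witness_def
    by (intro exI[of _ T] conjI ballI V T(1) nT onormT fixed small close near1)
qed

lemma ACK_rho_tensor:
  assumes "ACK_rho \<rho> sX" "ACK_rho \<rho> sY"
  shows "ACK_rho \<rho> sZ"
proof -
  obtain \<Gamma>X where \<Gamma>X: "one_norming sX \<Gamma>X"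
    and WX: "\<forall>\<epsilon>>0. \<forall>U. openin (subtopology (weak_star sX) \<Gamma>X) U \<and> U \<noteq> {} \<longrightarrow>
      (\<exists>V x1 e F. ACK_witness \<rho> sX \<Gamma>X \<epsilon> U V x1 e F)"
    using assms(1)[unfolded ACK_rho_iff] by - (elim exE conjE, rule that)
  obtain \<Gamma>Y where \<Gamma>Y: "one_norming sY \<Gamma>Y"
    and WY: "\<forall>\<epsilon>>0. \<forall>U. openin (subtopology (weak_star sY) \<Gamma>Y) U \<and> U \<noteq> {} \<longrightarrow>
      (\<exists>V x1 e F. ACK_witness \<rho> sY \<Gamma>Y \<epsilon> U V x1 e F)"
    using assms(2)[unfolded ACK_rho_iff] by - (elim exE conjE, rule that)
  have sub: "\<Gamma>X \<subseteq> dual_ball sX" "\<Gamma>Y \<subseteq> dual_ball sY"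
    using \<Gamma>X \<Gamma>Y by (auto simp: one_norming_def)
  show ?thesis
    unfolding ACK_rho_iff
  proof (rule exI[of _ "case_prod dual_tensor ` (\<Gamma>X \<times> \<Gamma>Y)"],
      intro conjI allI impI one_norming_dual_tensor \<Gamma>X \<Gamma>Y)
    fix \<epsilon> :: real and U
    assume \<epsilon>: "\<epsilon> > 0"
      and U: "openin (subtopology (weak_star sZ) (case_prod dual_tensor ` (\<Gamma>X \<times> \<Gamma>Y))) U \<and> U \<noteq> {}"
    obtain UX UY where
      UX: "openin (subtopology (weak_star sX) \<Gamma>X) UX" "UX \<noteq> {}" and
      UY: "openin (subtopology (weak_star sY) \<Gamma>Y) UY" "UY \<noteq> {}" and
      UXY: "case_prod dual_tensor ` (UX \<times> UY) \<subseteq> U"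
      using weak_star_open_rectangle[OF sub] U by metis
    define \<delta> where "\<delta> = min (\<epsilon> / 2) (1 / 2)"
    have "\<delta> > 0" using \<epsilon> by (simp add: \<delta>_def)
    obtain VX f1 eX F where "ACK_witness \<rho> sX \<Gamma>X \<delta> UX VX f1 eX F"
      using WX[rule_format, OF \<open>\<delta> > 0\<close> conjI[OF UX]] by blast
    moreover obtain VY g1 eY G where "ACK_witness \<rho> sY \<Gamma>Y \<delta> UY VY g1 eY G"
      using WY[rule_format, OF \<open>\<delta> > 0\<close> conjI[OF UY]] by blast
    moreover have "UX \<subseteq> \<Gamma>X" "UY \<subseteq> \<Gamma>Y"
      using openin_imp_subset UX(1) UY(1) by blast+
    ultimately show "\<exists>V x1 e F. ACK_witness \<rho> sZ (case_prod dual_tensor ` (\<Gamma>X \<times> \<Gamma>Y)) \<epsilon> U V x1 e F"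
      using ACK_witness_tensor[OF sub \<epsilon> \<delta>_def _ _ _ _ UXY] by blast
  qed
qed

end

theorem theorem4p12:
  fixes sX :: "'k::real_normed_field \<Rightarrow> 'a::banach \<Rightarrow> 'a"
    and sY :: "'k \<Rightarrow> 'b::banach \<Rightarrow> 'b"
    and sZ :: "'k \<Rightarrow> 'c::banach \<Rightarrow> 'c"
    and t :: "'a \<Rightarrow> 'b \<Rightarrow> 'c"
  assumes "banach_over sX" and "banach_over sY"
    and "injective_tensor_product sX sY sZ t"
  shows "(ACK sX \<and> ACK sY \<longrightarrow> ACK sZ) \<and>
    (\<forall>\<rho>. 0 \<le> \<rho> \<and> \<rho> < 1 \<and> ACK_rho \<rho> sX \<and> ACK_rho \<rho> sY \<longrightarrow> ACK_rho \<rho> sZ)"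
proof -
  have "ACK_rho \<rho> sZ" if X: "ACK_rho \<rho> sX" and Y: "ACK_rho \<rho> sY" for \<rho>
  proof -
    have "one_norming sX (dual_ball sX)" "one_norming sY (dual_ball sY)"
      using X Y unfolding ACK_rho_iff by (blast intro: one_norming_dual_ball)+
    then interpret injective_tensor sX sY sZ t
      using assms by (simp add: injective_tensor_def injective_tensor_axioms_def)
    show ?thesis using X Y by (rule ACK_rho_tensor)
  qed
  then show ?thesis unfolding ACK_eq_ACK_rho by blast
qed

end
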